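(* For all integers $n\ge 0$, $$\overline{R_{8,27}}(36n+15)\equiv 0 \pmod 8.$$
   Context: An overpartition of a nonnegative integer $n$ is a partition of $n$ (a non-increasing sequence of positive integers summing to $n$) in which the first occurrence of each part size may be overlined. For coprime positive integers $\ell,\mu$, $\overline{R_{\ell,\mu}}(n)$ denotes the number of overpartitions of $n$ in which no part is divisible by $\ell$ or by $\mu$ (with $\overline{R_{\ell,\mu}}(0)=1$). Its generating function, for $|q|<1$, is $$\sum_{n\ge 0}\overline{R_{\ell,\mu}}(n)q^n=\prod_{n=1}^{\infty}\frac{(1+q^{n})(1-q^{\ell n})(1-q^{\mu n})(1+q^{\ell\mu n})}{(1-q^{n})(1+q^{\ell n})(1+q^{\mu n})(1-q^{\ell\mu n})}.$$ The claim concerns $(\ell,\mu)=(8,27)$. *)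

theory Defs
  imports "HOL-Number_Theory.Cong"
begin

text \<open>
  An entry \<open>(k, b)\<close> is a part of size \<open>k\<close>; the flag \<open>b\<close> says whether it is overlined.
\<close>

definition overpartition :: "nat \<Rightarrow> (nat \<times> bool) list \<Rightarrow> bool" where
  "overpartition n ps \<longleftrightarrow>
     sorted_wrt (\<ge>) (map fst ps) \<and>
     (\<forall>p\<in>set ps. 0 < fst p) \<and>
     sum_list (map fst ps) = n \<and>
     (\<forall>i<length ps. snd (ps ! i) \<longrightarrow> (\<forall>j<i. fst (ps ! j) \<noteq> fst (ps ! i)))"

definition biregular_overpartitions :: "nat \<Rightarrow> nat \<Rightarrow> nat \<Rightarrow> (nat \<times> bool) list set" where
  "biregular_overpartitions l m n =
     {ps. overpartition n ps \<and> (\<forall>p\<in>set ps. \<not> l dvd fst p \<and> \<not> m dvd fst p)}"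

definition Rbar :: "nat \<Rightarrow> nat \<Rightarrow> nat \<Rightarrow> nat" where
  "Rbar l m n = card (biregular_overpartitions l m n)"

lemma finite_biregular_overpartitions: "finite (biregular_overpartitions l m n)"
proof (rule finite_subset)
  show "finite {ps. set ps \<subseteq> {..n} \<times> (UNIV :: bool set) \<and> length ps \<le> n}"
    by (rule finite_lists_length_le) simp
  have len: "length ps \<le> sum_list (map fst ps)"
    if "\<forall>p\<in>set ps. 0 < fst p" for ps :: "(nat \<times> bool) list"
    using that by (induction ps) auto
  have mem: "fst p \<le> sum_list (map fst ps)" if "p \<in> set ps" for p and ps :: "(nat \<times> bool) list"
    using that by (intro member_le_sum_list) auto
  show "biregular_overpartitions l m n \<subseteq> {ps. set ps \<subseteq> {..n} \<times> UNIV \<and> length ps \<le> n}"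
    unfolding biregular_overpartitions_def overpartition_def using len mem by fastforce
qed

lemma Rbar_0: "Rbar l m 0 = 1"
proof -
  have "biregular_overpartitions l m 0 = {[]}"
    unfolding biregular_overpartitions_def overpartition_def
    by (auto simp: neq_Nil_conv) (metis list.exhaust list.set_intros(1) not_gr0 surj_pair)
  then show ?thesis by (simp add: Rbar_def)
qed

end

theory Submission
  imports Defs "HOL-Library.FuncSet"
begin

text \<open>
  A partition with \<open>c\<close> distinct part sizes carries exactly \<open>2 ^ c\<close> choices of overlines, so modulo
  \<open>8\<close> only partitions with one or two distinct part sizes are visible. Let \<open>f i\<close> be the number
  of divisors of \<open>i\<close> that are allowed as parts, and let \<open>Q\<close> be the number of solutions of
  \<open>a * e + b * f = N\<close> with positive multiplicities \<open>e, f\<close> and allowed sizes \<open>b < a\<close>. Then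
  \<open>Rbar l m N\<close> is congruent to \<open>2 * f N + 4 * Q\<close> (\<open>Rbar_mod_8\<close>), so the claim is that
  \<open>f N + 2 * Q\<close> is divisible by \<open>4\<close> for \<open>N = 36 * n + 15\<close>.

  Dropping the condition \<open>b < a\<close> gives a convolution, minus the solutions with \<open>a = b\<close>
  (\<open>double_card_ordered_two_size_reps\<close>): \<open>2 * Q = T - S\<close>, where \<open>T\<close> sums \<open>f i * f (N - i)\<close> over
  \<open>0 < i < N\<close> and \<open>S\<close> sums \<open>N / d - 1\<close> over the allowed divisors \<open>d\<close> of \<open>N\<close>. Each of
  \<open>f N\<close>, \<open>S\<close> and \<open>T\<close> is divisible by \<open>4\<close>.

  For \<open>T\<close>: by inclusion-exclusion and the pairing \<open>d \<leftrightarrow> n / d\<close> of divisors, \<open>f i\<close> is odd only if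
  \<open>i\<close> is a square times \<open>1\<close>, \<open>8\<close>, \<open>27\<close> or \<open>216\<close> (\<open>odd_card_biregular_divisors\<close>). Residues modulo
  \<open>9\<close> and \<open>4\<close> exclude that \<open>i\<close> and \<open>N - i\<close> both have this form, so every summand of \<open>T\<close> is even, and
  since \<open>N\<close> is odd each summand occurs twice, for \<open>i\<close> and for \<open>N - i\<close>.

  For \<open>S\<close> and \<open>f N\<close>: all divisors of \<open>N\<close> are allowed, because \<open>N\<close> is odd and \<open>9\<close> does not divide it.
  Write \<open>N = 3 * k\<close>; the divisors of \<open>N\<close> are the divisors of \<open>k\<close> and their triples, which gives
  \<open>f N = 2 * \<tau>(k)\<close> and \<open>S = 4 * \<sigma>(k) - 2 * \<tau>(k)\<close>. Finally \<open>\<tau>(k)\<close> is even, since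
  \<open>k = 12 * n + 5\<close> is \<open>2\<close> modulo \<open>3\<close> and hence not a square.
\<close>

section \<open>Sums over involutions\<close>

text \<open>
  The involution \<open>h\<close> moves the key of every element, so it exchanges the elements whose key it lowers
  with those whose key it raises. Keeping the half where \<open>h\<close> lowers the key, rather than choosing
  orbit representatives, lets one fact serve the swap of two parts, the reflection \<open>i \<mapsto> N - i\<close>
  and the pairing of complementary divisors.
\<close>

lemma sum_involution_eq_double:
  fixes g :: "'a \<Rightarrow> nat" and key :: "'a \<Rightarrow> 'b::linorder"
  assumes "finite A"
    and h: "\<And>x. x \<in> A \<Longrightarrow> h x \<in> A" "\<And>x. x \<in> A \<Longrightarrow> h (h x) = x"
    and key: "\<And>x. x \<in> A \<Longrightarrow> key (h x) \<noteq> key x"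
    and g: "\<And>x. x \<in> A \<Longrightarrow> g (h x) = g x"
  shows "sum g A = 2 * sum g {x \<in> A. key (h x) < key x}"
proof -
  let ?L = "{x \<in> A. key (h x) < key x}" and ?R = "{x \<in> A. key x < key (h x)}"
  have "A = ?L \<union> ?R"
    using key neq_iff by blast
  then have "sum g A = sum g (?L \<union> ?R)" by simp
  also have "\<dots> = sum g ?L + sum g ?R"
    by (rule sum.union_disjoint) (use \<open>finite A\<close> in auto)
  also have "sum g ?R = sum g ?L"
    by (rule sum.reindex_bij_witness[of _ h h]) (use h g in auto)
  finally show ?thesis by simp
qed

section \<open>Overpartitions by number of part sizes\<close>

definition partitions_into :: "nat set \<Rightarrow> nat \<Rightarrow> nat list set" where
  "partitions_into A n = {xs. sorted_wrt (\<ge>) xs \<and> set xs \<subseteq> A \<and> sum_list xs = n}"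

definition overlinings :: "nat list \<Rightarrow> (nat \<times> bool) list set" where
  "overlinings xs = {ps. map fst ps = xs \<and>
     (\<forall>i<length ps. snd (ps ! i) \<longrightarrow> (\<forall>j<i. fst (ps ! j) \<noteq> fst (ps ! i)))}"

text \<open>
  Lists are extended at the right end because only the first copy of a size may be overlined: whether
  the last entry may be is decided by the entries before it, and the choices for those are unaffected.
\<close>

lemma overlinings_snoc:
  "overlinings (xs @ [x]) =
     (\<lambda>(ps, b). ps @ [(x, b)]) ` (overlinings xs \<times> {b. b \<longrightarrow> x \<notin> set xs})" (is "?L = ?R")
proof (intro equalityI subsetI)
  fix qs assume "qs \<in> ?L"
  then have qs: "map fst qs = xs @ [x]"
    and flag: "\<And>i j. i < length qs \<Longrightarrow> snd (qs ! i) \<Longrightarrow> j < i \<Longrightarrow> fst (qs ! j) \<noteq> fst (qs ! i)"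
    by (auto simp: overlinings_def)
  from qs obtain ps b where ps: "qs = ps @ [(x, b)]" "map fst ps = xs"
    by (auto simp: map_eq_append_conv)
  have "ps \<in> overlinings xs"
    unfolding overlinings_def
  proof (intro CollectI conjI allI impI)
    show "map fst ps = xs" by (fact ps)
    fix i j assume "i < length ps" "snd (ps ! i)" "j < i"
    then show "fst (ps ! j) \<noteq> fst (ps ! i)"
      using flag[of i j] ps by (simp add: nth_append)
  qed
  moreover have "x \<notin> set xs" if b
  proof
    assume "x \<in> set xs"
    then obtain j where "j < length ps" "fst (ps ! j) = x"
      unfolding ps(2)[symmetric] by (auto simp: in_set_conv_nth)
    then show False
      using flag[of "length ps" j] ps \<open>b\<close> by (simp add: nth_append)
  qed
  ultimately show "qs \<in> ?R" using ps by auto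
next
  fix qs assume "qs \<in> ?R"
  then obtain ps b where *: "qs = ps @ [(x, b)]" "ps \<in> overlinings xs" "b \<Longrightarrow> x \<notin> set xs"
    by auto
  have "fst (ps ! j) \<noteq> x" if b "j < length ps" for j
    using * that unfolding overlinings_def by auto
  then show "qs \<in> ?L"
    using * by (auto simp: overlinings_def nth_append less_Suc_eq)
qed

lemma card_overlinings: "card (overlinings xs) = 2 ^ card (set xs)"
proof (induction xs rule: rev_induct)
  case Nil
  have "overlinings [] = {[]}" by (auto simp: overlinings_def)
  then show ?case by simp
next
  case (snoc x xs)
  have "card (overlinings (xs @ [x])) = card (overlinings xs \<times> {b. b \<longrightarrow> x \<notin> set xs})"
    unfolding overlinings_snoc by (rule card_image) (auto simp: inj_on_def)
  also have "\<dots> = 2 ^ card (set xs) * card {b. b \<longrightarrow> x \<notin> set xs}"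
    by (simp add: card_cartesian_product snoc)
  also have "{b. b \<longrightarrow> x \<notin> set xs} = (if x \<in> set xs then {False} else {False, True})"
    by auto
  finally show ?case by (auto simp: insert_absorb)
qed

definition biregular_parts :: "nat \<Rightarrow> nat \<Rightarrow> nat set" where
  "biregular_parts l m = {d. \<not> l dvd d \<and> \<not> m dvd d}"

text \<open>
  Forgetting the overlines maps the overpartitions onto the partitions; the fibres are the sets of
  admissible overlinings. Positivity of parts comes for free, as \<open>0\<close> is a multiple of everything.
\<close>

lemma biregular_overpartitions_eq_UN:
  "biregular_overpartitions l m n =
     (\<Union>xs\<in>partitions_into (biregular_parts l m) n. overlinings xs)"
proof -
  have "ps \<in> biregular_overpartitions l m n \<longleftrightarrow>
      map fst ps \<in> partitions_into (biregular_parts l m) n \<and> ps \<in> overlinings (map fst ps)" for ps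
  proof -
    have "(\<forall>p\<in>set ps. 0 < fst p)" if "\<forall>p\<in>set ps. \<not> l dvd fst p \<and> \<not> m dvd fst p"
      using that by (metis dvd_0_right gr0I)
    then show ?thesis
      unfolding biregular_overpartitions_def overpartition_def partitions_into_def
        overlinings_def biregular_parts_def
      by auto
  qed
  then show ?thesis
    by (auto simp: overlinings_def)
qed

lemma finite_partitions_into:
  assumes "0 \<notin> A"
  shows "finite (partitions_into A n)"
proof (rule finite_subset)
  show "finite {xs. set xs \<subseteq> {..n} \<and> length xs \<le> n}"
    by (rule finite_lists_length_le) simp
  have len: "length xs \<le> sum_list xs" if "0 \<notin> set xs" for xs :: "nat list"
    using that by (induction xs) auto
  show "partitions_into A n \<subseteq> {xs. set xs \<subseteq> {..n} \<and> length xs \<le> n}"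
    using assms len by (auto simp: partitions_into_def intro: member_le_sum_list)
qed

lemma Rbar_eq_sum_power:
  "Rbar l m n = (\<Sum>xs\<in>partitions_into (biregular_parts l m) n. 2 ^ card (set xs))"
proof -
  have "finite (overlinings xs)" for xs
    using card_overlinings[of xs] by (intro card_ge_0_finite) simp
  then have "Rbar l m n = (\<Sum>xs\<in>partitions_into (biregular_parts l m) n. card (overlinings xs))"
    unfolding Rbar_def biregular_overpartitions_eq_UN
    by (intro card_UN_disjoint)
       (auto simp: overlinings_def biregular_parts_def intro!: finite_partitions_into)
  then show ?thesis by (simp add: card_overlinings)
qed

definition divisors_in :: "nat set \<Rightarrow> nat \<Rightarrow> nat set" where
  "divisors_in A n = {d \<in> A. d dvd n}"

text \<open>
  A quadruple \<open>(a, e, b, f)\<close> stands for \<open>e\<close> copies of the part \<open>a\<close> and \<open>f\<close> copies of the part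
  \<open>b\<close>. The sizes are not ordered and may coincide; partitions with two distinct sizes correspond
  to the quadruples with \<open>b < a\<close>, while without that condition the count is a convolution of divisor
  counts.
\<close>

definition two_size_reps :: "nat set \<Rightarrow> nat \<Rightarrow> (nat \<times> nat \<times> nat \<times> nat) set" where
  "two_size_reps A n =
     {(a, e, b, f). a \<in> A \<and> b \<in> A \<and> 0 < e \<and> 0 < f \<and> a * e + b * f = n}"

lemma finite_divisors_in: "0 < n \<Longrightarrow> finite (divisors_in A n)"
  by (rule finite_subset[of _ "{..n}"]) (auto simp: divisors_in_def dest: dvd_imp_le)

lemma finite_two_size_reps:
  assumes "0 \<notin> A"
  shows "finite (two_size_reps A n)"
proof (rule finite_subset)
  show "finite ({..n} \<times> {..n} \<times> {..n} \<times> {..n})" by simp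
  have le: "x \<le> n \<and> y \<le> n" if "x * y \<le> n" "0 < x" "0 < y" for x y :: nat
    using that by (metis dual_order.trans le_add1 mult.commute mult_le_mono2 nat_mult_1_right
        Suc_leI One_nat_def)
  show "two_size_reps A n \<subseteq> {..n} \<times> {..n} \<times> {..n} \<times> {..n}"
  proof
    fix p assume "p \<in> two_size_reps A n"
    then obtain a e b f where p: "p = (a, e, b, f)" "a \<in> A" "b \<in> A" "0 < e" "0 < f"
      "a * e + b * f = n"
      by (auto simp: two_size_reps_def)
    then have "0 < a" "0 < b" using assms by (metis gr0I)+
    then show "p \<in> {..n} \<times> {..n} \<times> {..n} \<times> {..n}"
      using le[of a e] le[of b f] p by auto
  qed
qed

lemma sorted_wrt_ge_replicate: "sorted_wrt (\<ge>) (replicate k (d::nat))"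
  by (induction k) auto

text \<open>
  A partition into equal parts is determined by its part size, which may be any allowed divisor.
\<close>

lemma card_one_size_partitions:
  assumes "0 < n" "0 \<notin> A"
  shows "card {xs \<in> partitions_into A n. card (set xs) = 1} = card (divisors_in A n)"
proof -
  have "bij_betw (\<lambda>d. replicate (n div d) d) (divisors_in A n)
      {xs \<in> partitions_into A n. card (set xs) = 1}" (is "bij_betw ?r _ ?P")
    unfolding bij_betw_def
  proof
    show "inj_on ?r (divisors_in A n)"
    proof (rule inj_onI)
      fix d d' assume dd: "d \<in> divisors_in A n" "d' \<in> divisors_in A n" "?r d = ?r d'"
      then have "n div d \<noteq> 0"
        using \<open>0 < n\<close> by (auto simp: divisors_in_def dvd_div_eq_0_iff)
      with dd(3) show "d = d'" by (metis replicate_eq_replicate)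
    qed
    show "?r ` divisors_in A n = ?P"
    proof (intro equalityI subsetI)
      fix xs assume "xs \<in> ?r ` divisors_in A n"
      then obtain d where d: "d \<in> A" "d dvd n" "xs = replicate (n div d) d"
        by (auto simp: divisors_in_def)
      then have "n div d \<noteq> 0"
        using \<open>0 < n\<close> by (auto simp: dvd_div_eq_0_iff)
      with d show "xs \<in> ?P"
        by (auto simp: partitions_into_def sorted_wrt_ge_replicate sum_list_replicate)
    next
      fix xs assume xs: "xs \<in> ?P"
      then obtain d where "set xs = {d}" by (auto simp: card_1_singleton_iff)
      then have rep: "xs = replicate (length xs) d"
        by (metis replicate_length_same singletonD)
      have "d \<in> A" "sum_list xs = n"
        using xs \<open>set xs = {d}\<close> by (auto simp: partitions_into_def)
      have "sum_list (replicate (length xs) d) = length xs * d"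
        by (simp add: sum_list_replicate)
      then have "length xs * d = n"
        using rep \<open>sum_list xs = n\<close> by simp
      moreover have "d \<noteq> 0" using assms \<open>d \<in> A\<close> by metis
      ultimately have "d \<in> divisors_in A n" "xs = ?r d"
        using rep \<open>d \<in> A\<close> by (auto simp: divisors_in_def)
      then show "xs \<in> ?r ` divisors_in A n" by blast
    qed
  qed
  then show ?thesis by (rule bij_betw_same_card[symmetric])
qed

lemma sorted_two_valued_eq_replicates:
  assumes "sorted_wrt (\<ge>) xs" "set xs \<subseteq> {a, b}" "b < (a::nat)"
  shows "\<exists>e f. xs = replicate e a @ replicate f b"
  using assms(1,2)
proof (induction xs)
  case Nil
  show ?case by simp
next
  case (Cons x xs)
  show ?case
  proof (cases "x = a")
    case True
    from Cons obtain e f where "xs = replicate e a @ replicate f b" by auto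
    then have "x # xs = replicate (Suc e) a @ replicate f b" using True by simp
    then show ?thesis by blast
  next
    case False
    then have "x = b" using Cons.prems by auto
    have "y = b" if "y \<in> set xs" for y
      using Cons.prems \<open>x = b\<close> \<open>b < a\<close> that by fastforce
    then have "xs = replicate (length xs) b" by (metis replicate_length_same)
    then have "x # xs = replicate 0 a @ replicate (Suc (length xs)) b" using \<open>x = b\<close> by simp
    then show ?thesis by blast
  qed
qed

lemma card_two_size_partitions:
  "card {xs \<in> partitions_into A n. card (set xs) = 2} =
     card {(a, e, b, f) \<in> two_size_reps A n. b < a}"
proof -
  let ?r = "\<lambda>(a, e, b, f). replicate e a @ replicate f (b::nat)"
  let ?Q = "{(a, e, b, f) \<in> two_size_reps A n. b < a}"
  let ?P = "{xs \<in> partitions_into A n. card (set xs) = 2}"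
  have "bij_betw ?r ?Q ?P"
    unfolding bij_betw_def
  proof
    show "inj_on ?r ?Q"
    proof (rule inj_onI)
      fix p q assume "p \<in> ?Q" "q \<in> ?Q" and eq: "?r p = ?r q"
      then obtain a e b f a' e' b' f' where
        p: "p = (a, e, b, f)" "0 < e" "0 < f" "b < a" and
        q: "q = (a', e', b', f')" "0 < e'" "0 < f'" "b' < a'"
        by (auto simp: two_size_reps_def)
      have eq': "replicate e a @ replicate f b = replicate e' a' @ replicate f' b'"
        using eq p q by simp
      have "hd (replicate e a @ replicate f b) = a" "hd (replicate e' a' @ replicate f' b') = a'"
        "last (replicate e a @ replicate f b) = b" "last (replicate e' a' @ replicate f' b') = b'"
        using p q by (auto simp: hd_append)
      then have ab: "a = a'" "b = b'" using eq' by simp_all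
      have "count_list (replicate e a @ replicate f b) a = e"
        "count_list (replicate e' a' @ replicate f' b') a' = e'"
        "count_list (replicate e a @ replicate f b) b = f"
        "count_list (replicate e' a' @ replicate f' b') b' = f'"
        using p q by (auto simp: count_list_eq_length_filter)
      then have "e = e'" "f = f'" using eq' ab by metis+
      then show "p = q" using ab p q by simp
    qed
    show "?r ` ?Q = ?P"
    proof (intro equalityI subsetI)
      fix xs assume "xs \<in> ?r ` ?Q"
      then obtain a e b f where "xs = replicate e a @ replicate f b" "a \<in> A" "b \<in> A"
        "0 < e" "0 < f" "a * e + b * f = n" "b < a"
        by (auto simp: two_size_reps_def)
      then show "xs \<in> ?P"
        by (auto simp: partitions_into_def sorted_wrt_append sorted_wrt_ge_replicate
            sum_list_replicate card_insert_if)
    next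
      fix xs assume xs: "xs \<in> ?P"
      then obtain a' b' where ab': "set xs = {a', b'}" "a' \<noteq> b'"
        by (auto simp: card_2_iff)
      then have "set xs = {max a' b', min a' b'}" "min a' b' < max a' b'"
        by (auto simp: max_def min_def)
      then obtain a b where ab: "set xs = {a, b}" "b < a" by blast
      then obtain e f where ef: "xs = replicate e a @ replicate f b"
        using sorted_two_valued_eq_replicates[of xs a b] xs by (auto simp: partitions_into_def)
      have "0 < e" "0 < f"
        using ef ab by (auto intro!: gr0I split: if_splits)
      moreover have "a * e + b * f = n"
        using xs ef by (auto simp: partitions_into_def sum_list_replicate mult.commute)
      moreover have "a \<in> A" "b \<in> A"
        using xs ab by (auto simp: partitions_into_def)
      ultimately have "(a, e, b, f) \<in> ?Q" using ab by (auto simp: two_size_reps_def)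
      moreover have "xs = ?r (a, e, b, f)" using ef by simp
      ultimately show "xs \<in> ?r ` ?Q" by blast
    qed
  qed
  then show ?thesis by (rule bij_betw_same_card[symmetric])
qed

text \<open>
  Exponents of at least three contribute multiples of \<open>8\<close>. The exponent zero is excluded because it would
  contribute \<open>1\<close>; for \<open>c\<close> the number of part sizes it occurs only at the empty partition.
\<close>

lemma sum_power_two_mod_8:
  fixes c :: "'a \<Rightarrow> nat"
  assumes "finite P" "\<And>x. x \<in> P \<Longrightarrow> 0 < c x"
  shows "[(\<Sum>x\<in>P. 2 ^ c x) = 2 * card {x \<in> P. c x = 1} + 4 * card {x \<in> P. c x = 2}] (mod 8)"
proof -
  let ?t = "\<lambda>x. 2 * of_bool (c x = 1) + 4 * of_bool (c x = 2) :: nat"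
  have "[2 ^ c x = ?t x] (mod 8)" if "x \<in> P" for x
  proof -
    have "c x = 1 \<or> c x = 2 \<or> (\<exists>k. c x = 3 + k)"
      using assms(2)[OF that] by presburger
    then show ?thesis
      by (auto simp: cong_def power_add)
  qed
  then have "[(\<Sum>x\<in>P. 2 ^ c x) = (\<Sum>x\<in>P. ?t x)] (mod 8)"
    by (rule cong_sum)
  also have "(\<Sum>x\<in>P. ?t x) = 2 * card {x \<in> P. c x = 1} + 4 * card {x \<in> P. c x = 2}"
    using \<open>finite P\<close> by (simp add: sum.distrib sum_distrib_left[symmetric] sum_of_bool_eq Int_def)
  finally show ?thesis .
qed

lemma Rbar_mod_8:
  assumes "0 < n"
  shows "[Rbar l m n = 2 * card (divisors_in (biregular_parts l m) n) +
     4 * card {(a, e, b, f) \<in> two_size_reps (biregular_parts l m) n. b < a}] (mod 8)"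
proof -
  have zero: "0 \<notin> biregular_parts l m" by (simp add: biregular_parts_def)
  let ?P = "partitions_into (biregular_parts l m) n"
  have "0 < card (set xs)" if "xs \<in> ?P" for xs
    using that assms by (auto simp: partitions_into_def card_gt_0_iff)
  then have "[(\<Sum>xs\<in>?P. 2 ^ card (set xs)) =
      2 * card {xs \<in> ?P. card (set xs) = 1} + 4 * card {xs \<in> ?P. card (set xs) = 2}] (mod 8)"
    by (rule sum_power_two_mod_8[OF finite_partitions_into[OF zero]])
  then show ?thesis
    unfolding card_one_size_partitions[OF assms zero] card_two_size_partitions Rbar_eq_sum_power .
qed

section \<open>Counting representations by two part sizes\<close>

text \<open>
  Sorting the quadruples by the share \<open>i = a * e\<close> of the first size leaves a free choice of an
  allowed divisor \<open>a\<close> of \<open>i\<close> and an allowed divisor \<open>b\<close> of \<open>n - i\<close>.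
\<close>

lemma card_two_size_reps:
  assumes "0 \<notin> A"
  shows "card (two_size_reps A n) =
     (\<Sum>i\<in>{0<..<n}. card (divisors_in A i) * card (divisors_in A (n - i)))"
proof -
  let ?S = "SIGMA i:{0<..<n}. divisors_in A i \<times> divisors_in A (n - i)"
  have pos: "0 < a" if "a \<in> A" for a using assms that by (metis gr0I)
  have "bij_betw (\<lambda>(i, a, b). (a, i div a, b, (n - i) div b)) ?S (two_size_reps A n)"
  proof (rule bij_betwI[where g = "\<lambda>(a, e, b, f). (a * e, a, b)"])
    show "(\<lambda>(i, a, b). (a, i div a, b, (n - i) div b)) \<in> ?S \<rightarrow> two_size_reps A n"
      using pos by (auto simp: two_size_reps_def divisors_in_def dvd_imp_le div_greater_zero_iff)
    show "(\<lambda>(a, e, b, f). (a * e, a, b)) \<in> two_size_reps A n \<rightarrow> ?S"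
      using pos by (auto simp: two_size_reps_def divisors_in_def)
  qed (use pos in \<open>auto simp: two_size_reps_def divisors_in_def\<close>)
  then have "card (two_size_reps A n) = card ?S"
    by (rule bij_betw_same_card[symmetric])
  also have "\<dots> = (\<Sum>i\<in>{0<..<n}. card (divisors_in A i \<times> divisors_in A (n - i)))"
    by (rule card_SigmaI) (auto simp: finite_divisors_in)
  finally show ?thesis by (simp add: card_cartesian_product)
qed

text \<open>
  For \<open>a = b = d\<close> the equation reads \<open>d * (e + f) = n\<close>, and \<open>n / d\<close> splits into two positive
  summands in \<open>n / d - 1\<close> ways.
\<close>

lemma card_diagonal_two_size_reps:
  assumes "0 \<notin> A" "0 < n"
  shows "card {(a, e, b, f) \<in> two_size_reps A n. a = b} = (\<Sum>d\<in>divisors_in A n. n div d - 1)"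
proof -
  let ?S = "SIGMA d:divisors_in A n. {0<..<n div d}"
  let ?D = "{(a, e, b, f) \<in> two_size_reps A n. a = b}"
  have pos: "0 < a" if "a \<in> A" for a using assms that by (metis gr0I)
  have "bij_betw (\<lambda>(d, e). (d, e, d, n div d - e)) ?S ?D"
  proof (rule bij_betwI[where g = "\<lambda>(a, e, b, f). (a, e)"])
    show "(\<lambda>(d, e). (d, e, d, n div d - e)) \<in> ?S \<rightarrow> ?D"
      using pos by (auto simp: two_size_reps_def divisors_in_def simp flip: distrib_left)
    show "(\<lambda>(a, e, b, f). (a, e)) \<in> ?D \<rightarrow> ?S"
      using pos by (auto simp: two_size_reps_def divisors_in_def simp flip: distrib_left)
  qed (use pos in \<open>auto simp: two_size_reps_def divisors_in_def simp flip: distrib_left\<close>)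
  then have "card ?D = card ?S"
    by (rule bij_betw_same_card[symmetric])
  also have "\<dots> = (\<Sum>d\<in>divisors_in A n. card {0<..<n div d})"
    by (rule card_SigmaI) (auto simp: finite_divisors_in assms)
  finally show ?thesis by simp
qed

text \<open>
  Exchanging the two sizes pairs the solutions having \<open>b < a\<close> with those having \<open>a < b\<close>; what remains
  of the convolution is the diagonal. Writing the diagonal on the left avoids a truncated subtraction.
\<close>

lemma double_card_ordered_two_size_reps:
  assumes "0 \<notin> A" "0 < n"
  shows "2 * card {(a, e, b, f) \<in> two_size_reps A n. b < a} + (\<Sum>d\<in>divisors_in A n. n div d - 1) =
     (\<Sum>i\<in>{0<..<n}. card (divisors_in A i) * card (divisors_in A (n - i)))"
proof -
  let ?U = "two_size_reps A n"
  let ?D = "{(a, e, b, f) \<in> ?U. a = b}" and ?O = "{(a, e, b, f) \<in> ?U. b < a}"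
  let ?N = "{(a, e, b, f) \<in> ?U. a \<noteq> b}"
  let ?swap = "\<lambda>(a, e, b, f). (b, f, a, e :: nat)"
  have fin: "finite ?U" by (rule finite_two_size_reps[OF assms(1)])
  have "card ?U = card (?N \<union> ?D)"
    by (rule arg_cong[of _ _ card]) auto
  also have "\<dots> = card ?N + card ?D"
    by (rule card_Un_disjoint) (auto intro: finite_subset[OF _ fin])
  also have "card ?N = 2 * (\<Sum>x\<in>{x \<in> ?N. fst (?swap x) < fst x}. 1)"
    unfolding card_eq_sum
    by (rule sum_involution_eq_double)
       (auto intro: finite_subset[OF _ fin] simp: two_size_reps_def)
  also have "{x \<in> ?N. fst (?swap x) < fst x} = ?O"
    by auto
  finally show ?thesis
    using card_two_size_reps[OF assms(1)] card_diagonal_two_size_reps[OF assms] by simp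
qed

section \<open>Parity of divisor counts\<close>

text \<open>
  If \<open>n = c * k\<close>, the divisors in question are \<open>c * y\<close> with \<open>y\<close> dividing \<open>k\<close>, and they are
  permuted by the involution sending \<open>y\<close> to \<open>k / y\<close>. A fixed point would make \<open>k\<close> a square. The case
  \<open>c = 1\<close> is the classical fact that only squares have an odd number of divisors.
\<close>

lemma even_card_multiples_dividing:
  fixes c n :: nat
  assumes "0 < n" "\<And>x. n \<noteq> c * x\<^sup>2"
  shows "even (card {d. c dvd d \<and> d dvd n})"
proof (cases "c dvd n")
  case False
  then have "{d. c dvd d \<and> d dvd n} = {}" by (auto dest: dvd_trans)
  then show ?thesis by (simp only: card.empty dvd_0_right)
next
  case True
  then obtain k where k: "n = c * k" by blast
  then have "0 < c" "0 < k" using assms(1) by auto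
  let ?A = "{d. c dvd d \<and> d dvd n}" and ?h = "\<lambda>d. c * (n div d)"
  have decomp: "\<exists>y z. d = c * y \<and> k = y * z \<and> 0 < y \<and> 0 < z" if "d \<in> ?A" for d
  proof -
    from that obtain y where y: "d = c * y" by blast
    with that k \<open>0 < c\<close> have "y dvd k" by simp
    then obtain z where "k = y * z" by blast
    then show ?thesis using y(1) \<open>0 < k\<close> by (intro exI[of _ y] exI[of _ z]) auto
  qed
  have hd: "?h (c * y) = c * z" if "k = y * z" "0 < y" for y z
    using that k \<open>0 < c\<close> by simp
  have "card ?A = 2 * (\<Sum>d\<in>{d \<in> ?A. ?h d < d}. 1)"
    unfolding card_eq_sum
  proof (rule sum_involution_eq_double[where key = "\<lambda>d. d"])
    show "finite ?A" by (rule finite_subset[of _ "{..n}"]) (auto dest: dvd_imp_le simp: assms(1))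
    fix d assume "d \<in> ?A"
    then obtain y z where yz: "d = c * y" "k = y * z" "0 < y" "0 < z" using decomp by blast
    have h1: "?h d = c * z" and h2: "?h (c * z) = c * y"
      using hd[of y z] hd[of z y] yz by (simp_all add: mult.commute)
    show "?h d \<in> ?A" using h1 k yz by simp
    show "?h (?h d) = d" unfolding h1 unfolding h2 by (simp only: yz(1))
    show "?h d \<noteq> d"
      using h1 yz k \<open>0 < c\<close> assms(2)[of y] by (auto simp: power2_eq_square)
  qed simp
  then show ?thesis by simp
qed

text \<open>
  By inclusion-exclusion this number of divisors is an alternating sum of the numbers of divisors that
  are multiples of \<open>1\<close>, \<open>l\<close>, \<open>m\<close> and \<open>l * m\<close>; coprimality makes the last the common multiples of
  \<open>l\<close> and \<open>m\<close>. If the whole is odd, so is one of the four terms.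
\<close>

lemma odd_card_biregular_divisors:
  assumes "0 < n" "coprime l m" "odd (card (divisors_in (biregular_parts l m) n))"
  shows "\<exists>c\<in>{1, l, m, l * m}. \<exists>x. n = c * x\<^sup>2"
proof (rule ccontr)
  assume *: "\<not> ?thesis"
  define M where "M c = {d. c dvd d \<and> d dvd n}" for c
  have ev: "even (card (M c))" if "c \<in> {1, l, m, l * m}" for c
    unfolding M_def using * that assms(1) by (intro even_card_multiples_dividing) auto
  have fin: "finite (M c)" for c
    unfolding M_def by (rule finite_subset[of _ "{..n}"]) (auto dest: dvd_imp_le simp: assms(1))
  have inter: "M l \<inter> M m = M (l * m)"
    using assms(2) by (auto simp: M_def divides_mult dest: dvd_mult_left dvd_mult_right)
  have "card (M l) + card (M m) = card (M l \<union> M m) + card (M (l * m))"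
    using card_Un_Int[OF fin fin, of l m] inter by simp
  then have "even (card (M l \<union> M m))"
    using ev[of l] ev[of m] ev[of "l * m"] by (metis even_add insertI1 insertI2)
  moreover have "card (M 1) = card (divisors_in (biregular_parts l m) n) + card (M l \<union> M m)"
  proof -
    have "M 1 = divisors_in (biregular_parts l m) n \<union> (M l \<union> M m)"
      by (auto simp: M_def divisors_in_def biregular_parts_def)
    then have "card (M 1) = card (divisors_in (biregular_parts l m) n \<union> (M l \<union> M m))" by simp
    also have "\<dots> = card (divisors_in (biregular_parts l m) n) + card (M l \<union> M m)"
      by (rule card_Un_disjoint)
         (use fin in \<open>auto simp: M_def divisors_in_def biregular_parts_def finite_divisors_in
            assms(1)\<close>)
    finally show ?thesis .
  qed
  ultimately show False
    using ev[of 1] assms(3) by (metis even_add insertI1)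
qed

text \<open>
  The divisors of \<open>p * k\<close> prime to \<open>p\<close> are the divisors of \<open>k\<close>; the others are \<open>p\<close> times a divisor
  of \<open>k\<close>.
\<close>

lemma sum_divisors_prime_mult:
  fixes p k :: nat and g :: "nat \<Rightarrow> nat"
  assumes "prime p" "\<not> p dvd k"
  shows "(\<Sum>d | d dvd p * k. g d) = (\<Sum>d | d dvd k. g d + g (p * d))"
proof -
  have "0 < k" "0 < p" using assms prime_gt_0_nat by (auto intro: gr0I)
  have eq: "{d. d dvd p * k} = {d. d dvd k} \<union> (*) p ` {d. d dvd k}"
  proof (intro equalityI subsetI)
    fix d assume d: "d \<in> {d. d dvd p * k}"
    show "d \<in> {d. d dvd k} \<union> (*) p ` {d. d dvd k}"
    proof (cases "p dvd d")
      case True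
      then show ?thesis using d \<open>0 < p\<close> by (auto elim!: dvdE[of p])
    next
      case False
      then have "coprime d p" using assms(1) by (metis coprime_commute prime_imp_coprime)
      then show ?thesis using d by (simp add: coprime_dvd_mult_right_iff)
    qed
  qed auto
  have fin: "finite {d. d dvd k}" using \<open>0 < k\<close> by simp
  have "(\<Sum>d | d dvd p * k. g d) = (\<Sum>d | d dvd k. g d) + (\<Sum>d\<in>(*) p ` {d. d dvd k}. g d)"
    unfolding eq by (rule sum.union_disjoint) (use fin assms in \<open>auto dest: dvd_mult_left\<close>)
  also have "(\<Sum>d\<in>(*) p ` {d. d dvd k}. g d) = (\<Sum>d | d dvd k. g (p * d))"
    using \<open>0 < p\<close> by (subst sum.reindex) (auto simp: inj_on_def)
  finally show ?thesis by (simp add: sum.distrib)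
qed

section \<open>Quadratic residues and the progression 36n + 15\<close>

lemma square_mod_4: "(x::nat)\<^sup>2 mod 4 \<in> {0, 1}"
proof -
  have "x mod 4 \<in> {0, 1, 2, 3}" by auto
  then show ?thesis by (subst power_mod[symmetric]) auto
qed

lemma square_mod_9: "(x::nat)\<^sup>2 mod 9 \<in> {0, 1, 4, 7}"
proof -
  have "x mod 9 \<in> {0, 1, 2, 3, 4, 5, 6, 7, 8}" by auto
  then show ?thesis by (subst power_mod[symmetric]) auto
qed

lemma square_mod_3: "(x::nat)\<^sup>2 mod 3 \<in> {0, 1}"
proof -
  have "x mod 3 \<in> {0, 1, 2}" by auto
  then show ?thesis by (subst power_mod[symmetric]) auto
qed

text \<open>
  Modulo \<open>9\<close> the coefficients are \<open>1\<close>, \<open>-1\<close>, \<open>0\<close>, \<open>0\<close> and the squares \<open>0\<close>, \<open>1\<close>, \<open>4\<close>, \<open>7\<close>;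
  the residue \<open>6\<close> arises only as \<open>7 - 1\<close>, that is, for the form \<open>x\<^sup>2 + 8 * y\<^sup>2\<close>. Modulo \<open>4\<close>
  that form is a square and cannot be \<open>3\<close>.
\<close>

lemma not_sum_of_scaled_squares:
  fixes x y n c d :: nat
  assumes "c \<in> {1, 8, 27, 216}" "d \<in> {1, 8, 27, 216}"
  shows "c * x\<^sup>2 + d * y\<^sup>2 \<noteq> 36 * n + 15"
proof
  assume eq: "c * x\<^sup>2 + d * y\<^sup>2 = 36 * n + 15"
  have "(c * x\<^sup>2 + d * y\<^sup>2) mod 4 = 3" unfolding eq by presburger
  then have 4: "((c mod 4) * (x\<^sup>2 mod 4) + (d mod 4) * (y\<^sup>2 mod 4)) mod 4 = 3"
    by (metis mod_add_eq mod_mult_eq)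
  have "(c * x\<^sup>2 + d * y\<^sup>2) mod 9 = 6" unfolding eq by presburger
  then have 9: "((c mod 9) * (x\<^sup>2 mod 9) + (d mod 9) * (y\<^sup>2 mod 9)) mod 9 = 6"
    by (metis mod_add_eq mod_mult_eq)
  have "c = 1 \<and> d = 8 \<or> c = 8 \<and> d = 1"
    if "((c mod 9) * u + (d mod 9) * v) mod 9 = 6" "u \<in> {0, 1, 4, 7}" "v \<in> {0, 1, 4, 7}" for u v
    using assms that by (elim insertE emptyE) simp_all
  from this[OF 9 square_mod_9 square_mod_9] have "c = 1 \<and> d = 8 \<or> c = 8 \<and> d = 1" .
  then show False
    using 4 square_mod_4[of x] square_mod_4[of y] by auto
qed

theorem theorem6p1:
  fixes n :: nat
  shows "[Rbar 8 27 (36 * n + 15) = 0] (mod 8)"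
proof -
  let ?A = "biregular_parts 8 27"
  define k where "k = 12 * n + 5"
  define N where "N = 36 * n + 15"
  define f where "f i = card (divisors_in ?A i)" for i
  define T where "T = (\<Sum>i\<in>{0<..<N}. f i * f (N - i))"
  define S where "S = (\<Sum>d\<in>divisors_in ?A N. N div d - 1)"
  define Q where "Q = card {(a, e, b, f) \<in> two_size_reps ?A N. b < a}"
  have Nk: "N = 3 * k" and "0 < N" "0 < k" by (simp_all add: N_def k_def)
  have zero: "0 \<notin> ?A" by (simp add: biregular_parts_def)

  have "\<not> 8 dvd N" "\<not> 27 dvd N" unfolding N_def by presburger+
  then have all: "divisors_in ?A N = {d. d dvd N}"
    by (auto simp: divisors_in_def biregular_parts_def dest: dvd_trans)
  have p3: "prime (3::nat)" "\<not> 3 dvd k" unfolding k_def by simp presburger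
  have "k \<noteq> 1 * x\<^sup>2" for x
  proof
    assume "k = 1 * x\<^sup>2"
    then have "x\<^sup>2 mod 3 = 2" unfolding k_def by presburger
    then show False using square_mod_3[of x] by simp
  qed
  from even_card_multiples_dividing[OF \<open>0 < k\<close> this]
  have tau: "even (card {d. d dvd k})" by simp

  have "f N = (\<Sum>d | d dvd 3 * k. 1)"
    by (simp add: f_def all flip: Nk)
  also have "\<dots> = 2 * card {d. d dvd k}"
    unfolding sum_divisors_prime_mult[OF p3] by simp
  finally have "f N = 2 * card {d. d dvd k}" .
  with tau have fN: "4 dvd f N" by auto

  have "S = (\<Sum>d | d dvd k. (3 * k div d - 1) + (3 * k div (3 * d) - 1))"
    unfolding S_def all unfolding Nk sum_divisors_prime_mult[OF p3] ..
  \<comment> \<open>Adding \<open>2\<close> for each divisor of \<open>k\<close> undoes the two truncated subtractions of \<open>1\<close>.\<close>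
  then have "S + 2 * card {d. d dvd k} = (\<Sum>d | d dvd k. (3 * k div d - 1) + (k div d - 1) + 2)"
    by (simp add: sum.distrib del: add_2_eq_Suc add_2_eq_Suc')
  also have "\<dots> = (\<Sum>d | d dvd k. 4 * (k div d))"
  proof (rule sum.cong)
    fix d assume "d \<in> {d. d dvd k}"
    then obtain e where e: "k = d * e" by auto
    with \<open>0 < k\<close> have "0 < d" "0 < e" by auto
    moreover have "3 * k div d = 3 * e"
      using e \<open>0 < d\<close> by (metis mult.left_commute nonzero_mult_div_cancel_left not_less0)
    ultimately show "(3 * k div d - 1) + (k div d - 1) + 2 = 4 * (k div d)"
      using e by simp
  qed simp
  finally have "S + 2 * card {d. d dvd k} = 4 * (\<Sum>d | d dvd k. k div d)"
    by (simp add: sum_distrib_left)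
  then have S4: "4 dvd S"
    using tau by presburger

  have "coprime 8 (27::nat)" by (simp add: coprime_iff_gcd_eq_1 gcd_non_0_nat)
  from odd_card_biregular_divisors[OF _ this]
  have scaled_square: "\<exists>c\<in>{1, 8, 27, 216}. \<exists>x. i = c * x\<^sup>2" if "0 < i" "odd (f i)" for i
    using that by (simp add: f_def)
  have pair_even: "even (f i * f (N - i))" if "i \<in> {0<..<N}" for i
  proof (rule ccontr)
    assume "odd (f i * f (N - i))"
    then have "odd (f i)" "odd (f (N - i))" by auto
    with that obtain c x d y where "c \<in> {1, 8, 27, 216}" "i = c * x\<^sup>2"
      "d \<in> {1, 8, 27, 216}" "N - i = d * y\<^sup>2"
      using scaled_square[of i] scaled_square[of "N - i"]
      by (metis greaterThanLessThan_iff zero_less_diff)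
    moreover have "i + (N - i) = N" using that by simp
    ultimately show False
      using not_sum_of_scaled_squares[of c d x y n] unfolding N_def by metis
  qed
  have "odd N" by (simp add: N_def)
  have "T = 2 * (\<Sum>i\<in>{i \<in> {0<..<N}. N - i < i}. f i * f (N - i))"
    unfolding T_def
    by (rule sum_involution_eq_double[where key = "\<lambda>i. i" and h = "\<lambda>i. N - i"])
       (use \<open>odd N\<close> in \<open>auto simp: mult.commute\<close>, presburger)
  moreover have "even (\<Sum>i\<in>{i \<in> {0<..<N}. N - i < i}. f i * f (N - i))"
    by (rule dvd_sum) (use pair_even in auto)
  ultimately have T4: "4 dvd T" by auto

  have "2 * Q + S = T"
    unfolding Q_def S_def T_def f_def by (rule double_card_ordered_two_size_reps[OF zero \<open>0 < N\<close>])
  with S4 T4 have "even Q" by presburger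
  have "[Rbar 8 27 N = 2 * f N + 4 * Q] (mod 8)"
    unfolding f_def Q_def by (rule Rbar_mod_8[OF \<open>0 < N\<close>])
  moreover have "8 dvd 2 * f N + 4 * Q" using fN \<open>even Q\<close> by presburger
  ultimately show ?thesis
    unfolding N_def by (metis cong_0_iff cong_trans)
qed

end
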